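(* Let $n$ be an odd prime, let $p$ be a prime, let $r$ be a positive integer, and let $d=p^r$. Then there is at most one pair $(x,y)$ of positive integers with $\gcd(x,y)=1$ satisfying $$(x-d)^2+x^2+(x+d)^2=y^n.$$ *)

theory Defs
  imports Complex_Main "HOL-Computational_Algebra.Primes"
begin

end

theory Submission
  imports Defs "HOL-Library.Discrete_Functions"
begin

text \<open>The equation reads \<open>3 x\<^sup>2 + 2 d\<^sup>2 = y^n\<close>.  Unique factorization of homogeneous elements in
  \<open>\<int>[\<surd>3, \<surd>-2]\<close> gives \<open>x \<surd>3 + d \<surd>-2 = (u \<surd>3 + v \<surd>-2)^n\<close>, hence \<open>y = 3 u\<^sup>2 + 2 v\<^sup>2\<close> and
  \<open>d = v L\<close> for a polynomial \<open>L\<close> in \<open>3 u\<^sup>2\<close> and \<open>-2 v\<^sup>2\<close>.  Since \<open>d = p^r\<close>, the value of \<open>\<bar>v\<bar>\<close> is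
  forced: for \<open>p = 2\<close> the number \<open>L\<close> is odd, so \<open>\<bar>v\<bar> = d\<close>; for odd \<open>p\<close> a 2-adic argument excludes
  \<open>L = 1\<close> (and \<open>L \<equiv> 1\<close> modulo 3), so \<open>p\<close> divides \<open>L\<close>, and the first and last terms of \<open>L\<close> show
  \<open>\<bar>v\<bar> = d / p\<close> if \<open>p = n\<close> and \<open>\<bar>v\<bar> = 1\<close> otherwise.  For fixed \<open>v\<close> the sign of \<open>L\<close> is determined
  modulo 3, and \<open>L\<close> is 2-adically injective as a function of \<open>3 u\<^sup>2\<close>.\<close>

section \<open>The odd part of a binomial power\<close>

declare binomial_Suc_Suc [simp del]

text \<open>With \<open>w = a\<^sup>2\<close> and \<open>z = b\<^sup>2\<close>, the part of \<open>(a + b)^(2m+1)\<close> that is odd in \<open>b\<close> is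
  \<open>b * lehmer_poly m w z\<close>.\<close>

definition lehmer_poly :: "nat \<Rightarrow> int \<Rightarrow> int \<Rightarrow> int" where
  "lehmer_poly m w z = (\<Sum>j\<le>m. int (2 * m + 1 choose (2 * j + 1)) * w ^ (m - j) * z ^ j)"

section \<open>2-adic valuations of binomial coefficients and of power differences\<close>

lemma binomial_odd_absorption:
  assumes "j \<ge> 1"
  shows "j * ((2 * j + 1) * (2 * m + 1 choose (2 * j + 1))) = (2 * m + 1) * (m * (2 * m - 1 choose (2 * j - 1)))"
proof -
  have "(2 * j + 1) * (2 * m + 1 choose (2 * j + 1)) = (2 * m + 1) * (2 * m choose (2 * j))"
    using times_binomial_minus1_eq[of "2 * j + 1" "2 * m + 1"] by simp
  moreover have "2 * j * (2 * m choose (2 * j)) = 2 * m * (2 * m - 1 choose (2 * j - 1))"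
    using times_binomial_minus1_eq[of "2 * j" "2 * m"] assms by simp
  then have "j * (2 * m choose (2 * j)) = m * (2 * m - 1 choose (2 * j - 1))"
    by simp
  ultimately show ?thesis by (metis mult.left_commute)
qed

lemma odd_cofactor:
  fixes c x b :: int
  assumes "odd c" "odd b" "c * x = 2 ^ e * b"
  obtains b' where "odd b'" "x = 2 ^ e * b'"
proof -
  have "coprime (2 ^ e) c" using assms(1) by simp
  moreover have "2 ^ e dvd c * x" using assms(3) by simp
  ultimately obtain k where k: "x = 2 ^ e * k"
    by (metis coprime_dvd_mult_right_iff dvdE)
  with assms(3) have "c * k = b" by simp
  with assms(2) have "odd k" by auto
  with k that show ?thesis by blast
qed

text \<open>If \<open>2 ^ a\<close> is the exact power of 2 in \<open>j\<close>, the first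
  hypothesis leaves \<open>2 ^ e dvd 2 ^ a * C\<close>. From
  \<open>2 ^ a \<le> j < 2 ^ (j - c + 1)\<close> follows \<open>a + c \<le> j\<close>, so replacing
  \<open>2 ^ a\<close> by \<open>2 ^ j\<close> gains at least \<open>c\<close> factors 2.\<close>

lemma two_power_dvd_two_power_mult:
  fixes j C :: nat
  assumes "2 ^ e dvd j * C" "j \<ge> 1" "j < 2 ^ (j - c + 1)" "c \<le> j"
  shows "2 ^ (e + c) dvd 2 ^ j * C"
proof -
  obtain k where k: "j = 2 ^ multiplicity 2 j * k" "odd k"
    using multiplicity_decompose'[of j 2] assms(2) by auto
  define a where "a = multiplicity 2 j"
  have "2 ^ a \<le> j" using k(1) assms(2) unfolding a_def
    by (intro dvd_imp_le) (metis dvd_triv_left, simp)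
  then have "(2::nat) ^ a < 2 ^ (j - c + 1)" using assms(3) by linarith
  then have "a < j - c + 1" by (rule power_less_imp_less_exp[rotated]) simp
  then have ac: "a + c \<le> j" using assms(4) by simp
  have "2 ^ e dvd k * (2 ^ a * C)"
    using assms(1) k(1) unfolding a_def by (metis mult.assoc mult.commute)
  moreover have "coprime (2 ^ e) k" using k(2) by simp
  ultimately have "2 ^ e dvd 2 ^ a * C" by (simp add: coprime_dvd_mult_right_iff)
  then have "2 ^ e * 2 ^ c dvd 2 ^ a * C * 2 ^ c" by (rule mult_dvd_mono) simp
  also have "2 ^ a * C * 2 ^ c = 2 ^ (a + c) * C" by (simp add: power_add)
  also have "\<dots> dvd 2 ^ j * C" using ac by (intro mult_dvd_mono le_imp_power_dvd) auto
  finally show ?thesis by (simp add: power_add)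
qed

text \<open>For even \<open>z\<close>, the factor \<open>2 ^ j\<close> comes from
  \<open>z ^ j\<close> in the terms of \<open>lehmer_poly\<close>. The surplus is needed as
  \<open>c = 1\<close> for all \<open>j \<ge> 1\<close> and as \<open>c = 2\<close> for
  \<open>j \<ge> 3\<close>.\<close>

lemma two_power_dvd_binomial:
  assumes "2 ^ e dvd m" "j \<ge> 1" "j < 2 ^ (j - c + 1)" "c \<le> j"
  shows "2 ^ (e + c) dvd 2 ^ j * int (2 * m + 1 choose (2 * j + 1))"
proof -
  let ?C = "2 * m + 1 choose (2 * j + 1)"
  have "2 ^ e dvd (2 * j + 1) * (j * ?C)"
    using binomial_odd_absorption[OF assms(2), of m] assms(1)
    by (metis dvd_mult dvd_mult2 mult.left_commute)
  moreover have "coprime (2 ^ e) (2 * j + 1)" by simp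
  ultimately have "2 ^ e dvd j * ?C" by (metis coprime_dvd_mult_right_iff)
  from two_power_dvd_two_power_mult[OF this assms(2-4)]
  have "int (2 ^ (e + c)) dvd int (2 ^ j * ?C)" by (simp only: of_nat_dvd_iff)
  then show ?thesis by simp
qed

text \<open>Lifting the exponent at 2. An odd exponent adds no factor 2, because the cofactor is a
  sum of oddly many odd terms; each squaring adds exactly one, because \<open>X + Y\<close> is 2
  modulo 4 when \<open>4 dvd X - Y\<close> and \<open>Y\<close> is odd.\<close>

lemma two_adic_power_diff:
  fixes x y :: int
  assumes "odd y" "4 dvd x - y" "odd k"
  shows "\<exists>b. odd b \<and> x ^ (2 ^ e * k) - y ^ (2 ^ e * k) = (x - y) * (2 ^ e * b)"
proof (induction e)
  case 0
  have "odd x" using assms(1,2) by presburger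
  then have "odd (\<Sum>i<k. y ^ (k - Suc i) * x ^ i)"
    using assms(1,3) by (simp add: even_sum_iff)
  then show ?case using power_diff_sumr2[of x k y] by auto
next
  case (Suc e)
  define X Y where "X = x ^ (2 ^ e * k)" and "Y = y ^ (2 ^ e * k)"
  from Suc obtain b where b: "odd b" "X - Y = (x - y) * (2 ^ e * b)"
    unfolding X_def Y_def by blast
  have "4 dvd X - Y" using b(2) assms(2) by simp
  moreover have "odd Y" unfolding Y_def using assms(1) by simp
  ultimately have "X + Y = 2 * ((X + Y) div 2)" "odd ((X + Y) div 2)" by presburger+
  then obtain c where c: "X + Y = 2 * c" "odd c" by blast
  have "x ^ (2 ^ Suc e * k) - y ^ (2 ^ Suc e * k) = X ^ 2 - Y ^ 2"
    unfolding X_def Y_def by (simp add: power_mult [symmetric] mult_ac)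
  also have "\<dots> = (X - Y) * (X + Y)" by (simp add: power2_eq_square algebra_simps)
  also have "\<dots> = (x - y) * (2 ^ Suc e * (b * c))" using b c by simp
  finally show ?case using b c by (intro exI[of _ "b * c"]) simp
qed

section \<open>Injectivity, congruences and the value 1 of \<open>lehmer_poly\<close>\<close>

lemma lehmer_poly_split:
  assumes "k \<le> m"
  shows "lehmer_poly m w z = (\<Sum>j\<le>k. int (2 * m + 1 choose (2 * j + 1)) * w ^ (m - j) * z ^ j)
           + (\<Sum>j\<in>{k<..m}. int (2 * m + 1 choose (2 * j + 1)) * w ^ (m - j) * z ^ j)"
proof -
  have "{..m} = {..k} \<union> {k<..m}" using assms by auto
  then show ?thesis unfolding lehmer_poly_def
    by (simp add: sum.union_disjoint ivl_disj_int)
qed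

text \<open>The difference of the leading terms has 2-adic valuation \<open>v(m) + v(w1 - w2)\<close>, all other
  differences have a larger one.\<close>

lemma lehmer_poly_inj:
  assumes "odd w2" "4 dvd w1 - w2" "even z" "m \<ge> 1" "lehmer_poly m w1 z = lehmer_poly m w2 z"
  shows "w1 = w2"
proof (rule ccontr)
  assume ne: "w1 \<noteq> w2"
  obtain t where t: "z = 2 * t" using assms(3) by blast
  obtain e k where m: "m = 2 ^ e * k" "odd k"
    using multiplicity_decompose'[of m 2] assms(4) by (metis not_one_le_zero odd_one)
  obtain b where b: "odd b" "w1 ^ m - w2 ^ m = (w1 - w2) * (2 ^ e * b)"
    using two_adic_power_diff[OF assms(1,2) m(2)] m(1) by blast
  let ?C = "\<lambda>j. int (2 * m + 1 choose (2 * j + 1))"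
  have "(w1 - w2) * 2 ^ (e + 1) dvd ?C j * w1 ^ (m - j) * z ^ j - ?C j * w2 ^ (m - j) * z ^ j"
    if "j \<in> {0<..m}" for j
  proof -
    have "2 ^ (e + 1) dvd 2 ^ j * ?C j"
      using that m(1) by (intro two_power_dvd_binomial) auto
    moreover have "w1 - w2 dvd w1 ^ (m - j) - w2 ^ (m - j)"
      using power_diff_sumr2 by (metis dvd_triv_left)
    ultimately have "(w1 - w2) * 2 ^ (e + 1) dvd (w1 ^ (m - j) - w2 ^ (m - j)) * (2 ^ j * ?C j)"
      by (rule mult_dvd_mono[rotated])
    then have "(w1 - w2) * 2 ^ (e + 1) dvd (w1 ^ (m - j) - w2 ^ (m - j)) * (2 ^ j * ?C j) * t ^ j"
      by (rule dvd_mult2)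
    then show ?thesis by (simp add: t power_mult_distrib algebra_simps)
  qed
  then have "(w1 - w2) * 2 ^ (e + 1) dvd (\<Sum>j\<in>{0<..m}. ?C j * w1 ^ (m - j) * z ^ j - ?C j * w2 ^ (m - j) * z ^ j)"
    by (rule dvd_sum)
  \<comment> \<open>The two values agree, so the differences for \<open>j > 0\<close> cancel the
    leading one, whose power of 2 is one too small.\<close>
  also have "\<dots> = - (int (2 * m + 1) * (w1 ^ m - w2 ^ m))"
    using assms(5) lehmer_poly_split[of 0 m w1 z] lehmer_poly_split[of 0 m w2 z]
    by (simp add: sum_subtractf algebra_simps)
  also have "\<dots> = (w1 - w2) * (2 ^ e * - (int (2 * m + 1) * b))" by (simp add: b(2))
  finally have "2 ^ e * 2 dvd 2 ^ e * - (int (2 * m + 1) * b)"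
    using ne by (simp add: mult.assoc mult_ac)
  then have "even (int (2 * m + 1) * b)"
    by (subst (asm) dvd_times_left_cancel_iff) auto
  with b(1) show False by simp
qed

text \<open>Only the term \<open>j = m\<close>, with coefficient 1, is free of \<open>w\<close>.
  This congruence later rules out a change of sign.\<close>

lemma lehmer_poly_mod_3:
  assumes "3 dvd w" "z mod 3 = 1"
  shows "lehmer_poly m w z mod 3 = 1"
proof -
  have "3 dvd (\<Sum>j<m. int (2 * m + 1 choose (2 * j + 1)) * w ^ (m - j) * z ^ j)"
    using assms(1) by (intro dvd_sum dvd_mult dvd_mult2 dvd_power) auto
  moreover have "lehmer_poly m w z = (\<Sum>j<m. int (2 * m + 1 choose (2 * j + 1)) * w ^ (m - j) * z ^ j) + z ^ m"
    unfolding lehmer_poly_def by (simp flip: lessThan_Suc_atMost)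
  moreover have "z ^ m mod 3 = 1" using power_mod[of z 3 m] assms(2) by simp
  ultimately show ?thesis by (simp add: dvd_eq_mod_eq_0 mod_add_eq[symmetric])
qed

lemma dvd_lehmer_poly_minus_lead:
  assumes "q dvd z"
  shows "q dvd lehmer_poly m w z - int (2 * m + 1) * w ^ m"
proof -
  have "q dvd (\<Sum>j\<in>{0<..m}. int (2 * m + 1 choose (2 * j + 1)) * w ^ (m - j) * z ^ j)"
    using assms by (intro dvd_sum dvd_mult) (auto intro: dvd_power dvd_trans)
  then show ?thesis using lehmer_poly_split[of 0 m w z] by simp
qed

lemma prime_dvd_lehmer_poly_minus_last:
  assumes "prime (2 * m + 1)"
  shows "int (2 * m + 1) dvd lehmer_poly m w z - z ^ m"
proof -
  have "int (2 * m + 1) dvd int (2 * m + 1 choose (2 * j + 1))" if "j < m" for j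
    unfolding of_nat_dvd_iff using that assms by (intro dvd_choose_prime) auto
  then have "int (2 * m + 1) dvd (\<Sum>j<m. int (2 * m + 1 choose (2 * j + 1)) * w ^ (m - j) * z ^ j)"
    by (intro dvd_sum dvd_mult2) auto
  then show ?thesis unfolding lehmer_poly_def by (simp flip: lessThan_Suc_atMost)
qed

text \<open>For odd \<open>m\<close> the sum is 3 modulo 4.  For even \<open>m\<close> and \<open>e = v(m)\<close>, the contributions
  \<open>2 m w^m\<close>, \<open>j = 1\<close> and \<open>j = 2\<close> are each an odd multiple of \<open>2^(e+1)\<close>, and the rest of
  \<open>lehmer_poly m w (2 * t) - 1\<close> is divisible by \<open>2^(e+2)\<close>.\<close>

lemma lehmer_poly_ne_1:
  assumes "w mod 4 = 3" "odd t" "m \<ge> 1"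
  shows "lehmer_poly m w (2 * t) \<noteq> 1"
proof
  assume L: "lehmer_poly m w (2 * t) = 1"
  let ?C = "\<lambda>j. int (2 * m + 1 choose (2 * j + 1))"
  have w: "odd w" using assms(1) by presburger
  have C3: "3 * ?C 1 = (2 * int m + 1) * (int m * (2 * int m - 1))"
  proof -
    have "int (3 * (2 * m + 1 choose 3)) = int ((2 * m + 1) * (m * (2 * m - 1)))"
      using binomial_odd_absorption[of 1 m] by simp
    then have "3 * int (2 * m + 1 choose 3) = int (2 * m + 1) * (int m * int (2 * m - 1))"
      by (simp only: of_nat_mult of_nat_numeral)
    then show ?thesis using assms(3) by (simp add: of_nat_diff)
  qed
  show False
  proof (cases "even m")
    case False
    have "4 dvd (\<Sum>j\<in>{1<..m}. ?C j * w ^ (m - j) * (2 * t) ^ j)"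
    proof (rule dvd_sum)
      fix j assume "j \<in> {1<..m}"
      then have "(2::int) ^ 2 dvd (2 * t) ^ j"
        by (intro dvd_trans[OF le_imp_power_dvd[of 2 j] dvd_power_same]) auto
      then show "4 dvd ?C j * w ^ (m - j) * (2 * t) ^ j" by simp
    qed
    also have "\<dots> = 1 - (int (2 * m + 1) * w ^ m + ?C 1 * w ^ (m - 1) * (2 * t))"
      using lehmer_poly_split[of 1 m w "2 * t"] L assms(3) by (simp add: algebra_simps)
    finally have "4 dvd 1 - (int (2 * m + 1) * w ^ m + ?C 1 * w ^ (m - 1) * (2 * t))" .
    moreover have "odd (?C 1 * w ^ (m - 1) * t)"
    proof -
      have "odd (3 * ?C 1)" unfolding C3 using False by simp
      then show ?thesis using w assms(2) by simp
    qed
    moreover have "w ^ m mod 4 = 3"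
    proof -
      obtain k where k: "m = 2 * k + 1" using False by (metis oddE)
      have "w ^ 2 mod 4 = 1" using power_mod[of w 4 2] assms(1) by simp
      then have "(w ^ 2) ^ k mod 4 = 1 ^ k mod 4" using power_mod[of "w ^ 2" 4 k] by simp
      then have "(w ^ 2) ^ k mod 4 = 1" by simp
      then have "(w ^ 2) ^ k * w mod 4 = 1 * 3 mod 4" using assms(1) by (metis mod_mult_eq mult_1 mod_mod_trivial)
      then show ?thesis by (simp add: k power_mult [symmetric] mult.commute)
    qed
    then have "int (2 * m + 1) * w ^ m mod 4 = 1"
    proof -
      assume a: "w ^ m mod 4 = 3"
      have "int (2 * m + 1) mod 4 = 3" using False by presburger
      then show ?thesis using a mod_mult_eq[of "int (2 * m + 1)" 4 "w ^ m"] by simp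
    qed
    moreover have False if "4 dvd 1 - (a + b * (2 * t))" "odd (b * t)" "a mod 4 = 1" for a b :: int
    proof -
      define c where "c = b * t"
      have "4 dvd 1 - (a + 2 * c)" using that(1) unfolding c_def by (simp only: mult_ac)
      moreover have "odd c" using that(2) unfolding c_def .
      ultimately show False using that(3) by presburger
    qed
    ultimately show False by blast
  next
    case True
    obtain e k where m: "m = 2 ^ e * k" "odd k"
      using multiplicity_decompose'[of m 2] assms(3) by (metis not_one_le_zero odd_one)
    have e: "e \<ge> 1" using m True by (cases e) auto
    have m2: "m \<ge> 2" using True assms(3) by presburger
    have im: "int m = 2 ^ e * int k" using m(1) by simp
    obtain c3 where c3: "odd c3" "?C 1 = 2 ^ e * c3"
    proof (rule odd_cofactor)
      show "3 * ?C 1 = 2 ^ e * (int k * (2 * int m + 1) * (2 * int m - 1))"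
        unfolding C3 by (simp add: m(1) mult_ac)
    qed (use m(2) in auto)
    \<comment> \<open>Two absorptions give 30 times the coefficient as
      \<open>(2m+1) m (2m-1) (m-1) (2m-3)\<close>. As \<open>m\<close> is even, every factor other
      than \<open>m\<close> is odd, and 30 is twice an odd number.\<close>
    obtain c5 where c5: "odd c5" "2 * ?C 2 = 2 ^ e * c5"
    proof (rule odd_cofactor)
      have C5: "2 * (5 * (2 * m + 1 choose 5)) = (2 * m + 1) * (m * (2 * m - 1 choose 3))"
        using binomial_odd_absorption[of 2 m] by simp
      have C3: "3 * (2 * m - 1 choose 3) = (2 * m - 1) * (2 * m - 2 choose 2)"
        using times_binomial_minus1_eq[of 3 "2 * m - 1"] by (simp add: eval_nat_numeral)
      have "2 * (2 * m - 2 choose 2) = 2 * ((m - 1) * (2 * m - 3))"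
        using times_binomial_minus1_eq[of 2 "2 * m - 2"] by (simp add: diff_mult_distrib2 diff_mult_distrib)
      then have C2: "(2 * m - 2 choose 2) = (m - 1) * (2 * m - 3)" by simp
      have "30 * (2 * m + 1 choose 5) = 3 * (2 * (5 * (2 * m + 1 choose 5)))" by simp
      also have "\<dots> = (2 * m + 1) * (m * (3 * (2 * m - 1 choose 3)))"
        by (simp only: C5 mult.left_commute)
      also have "\<dots> = (2 * m + 1) * (m * ((2 * m - 1) * ((m - 1) * (2 * m - 3))))"
        by (simp only: C3 C2)
      finally have "30 * (2 * m + 1 choose 5) = (2 * m + 1) * (m * ((2 * m - 1) * ((m - 1) * (2 * m - 3))))" .
      then have "int (30 * (2 * m + 1 choose 5)) = int ((2 * m + 1) * (m * ((2 * m - 1) * ((m - 1) * (2 * m - 3)))))"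
        by (rule arg_cong)
      then have "30 * ?C 2 = int (2 * m + 1) * (int m * (int (2 * m - 1) * (int (m - 1) * int (2 * m - 3))))"
        by (simp only: of_nat_mult of_nat_numeral) simp
      moreover have "int (2 * m - 1) = 2 * int m - 1" "int (m - 1) = int m - 1" "int (2 * m - 3) = 2 * int m - 3"
        "int (2 * m + 1) = 2 * int m + 1"
        using m2 by (simp_all add: of_nat_diff)
      ultimately show "15 * (2 * ?C 2) = 2 ^ e * (int k * (2 * int m + 1) * (2 * int m - 1) * (int m - 1) * (2 * int m - 3))"
        using im by (simp add: mult_ac)
    qed (use m(2) True in auto)
    \<comment> \<open>Here \<open>w ^ m\<close> is a power of \<open>w\<^sup>2\<close> with exponent
      \<open>m / 2\<close>: 8 divides \<open>w\<^sup>2 - 1\<close>, and the exponent contributes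
      \<open>2 ^ (e - 1)\<close>.\<close>
    have w1: "2 ^ (e + 2) dvd w ^ m - 1"
    proof -
      obtain c where c: "w = 2 * c + 1" using w by (metis oddE)
      have "even (c * (c + 1))" by simp
      then have "2 * 4 dvd c * (c + 1) * 4" by (rule mult_dvd_mono) simp
      also have "c * (c + 1) * 4 = w\<^sup>2 - 1" by (simp add: c power2_eq_square algebra_simps)
      finally have w8: "2 ^ 3 dvd w\<^sup>2 - 1" by simp
      have "4 dvd w\<^sup>2 - 1" by (rule dvd_trans[OF _ w8]) simp
      then obtain b where b: "(w\<^sup>2) ^ (2 ^ (e - 1) * k) - 1 ^ (2 ^ (e - 1) * k) = (w\<^sup>2 - 1) * (2 ^ (e - 1) * b)"
        using two_adic_power_diff[of 1 "w\<^sup>2" k "e - 1"] m(2) by auto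
      have "m = 2 * (2 ^ (e - 1) * k)" using m(1) e by (cases e) simp_all
      then have "w ^ m = (w\<^sup>2) ^ (2 ^ (e - 1) * k)" by (simp only: power_mult)
      then have "w ^ m - 1 = (w\<^sup>2 - 1) * 2 ^ (e - 1) * b"
        using b by (simp only: power_one mult.assoc)
      moreover have "2 ^ 3 * 2 ^ (e - 1) dvd (w\<^sup>2 - 1) * 2 ^ (e - 1) * b"
        using w8 by (intro dvd_mult2 mult_dvd_mono) auto
      moreover have "(2::int) ^ 3 * 2 ^ (e - 1) = 2 ^ (e + 2)"
        using e by (cases e) simp_all
      ultimately show ?thesis by metis
    qed
    define S where "S = (\<Sum>j\<in>{2<..m}. ?C j * w ^ (m - j) * (2 * t) ^ j)"
    have S: "2 ^ (e + 2) dvd S"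
      unfolding S_def
    proof (rule dvd_sum)
      fix j assume j: "j \<in> {2<..m}"
      \<comment> \<open>This bound, required for surplus 2, fails at \<open>j = 1\<close> and
        \<open>j = 2\<close>, so those terms stay outside \<open>S\<close>.\<close>
      have less: "j < 2 ^ (j - 1)" if "j \<ge> 3" for j :: nat
      proof (use that in \<open>induction j rule: dec_induct\<close>)
        case (step j)
        then obtain i where "j = Suc i" by (cases j) auto
        with step show ?case by simp
      qed simp
      have "2 ^ (e + 2) dvd 2 ^ j * ?C j"
        using j m(1) less[of j] by (intro two_power_dvd_binomial) (auto simp: Suc_diff_Suc numeral_2_eq_2)
      then have "2 ^ (e + 2) dvd 2 ^ j * ?C j * (w ^ (m - j) * t ^ j)" by (rule dvd_mult2)
      then show "2 ^ (e + 2) dvd ?C j * w ^ (m - j) * (2 * t) ^ j"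
        by (simp add: power_mult_distrib mult_ac)
    qed
    \<comment> \<open>With the leading term written as \<open>2 m w^m + (w^m - 1) + 1\<close>,
      everything of valuation \<open>e + 1\<close> is collected here; the bracket is a sum of three
      odd numbers.\<close>
    have "2 ^ (e + 1) * (int k * w ^ m + c3 * w ^ (m - 1) * t + c5 * w ^ (m - 2) * t ^ 2)
      = 2 * int m * w ^ m + ?C 1 * w ^ (m - 1) * (2 * t) + 2 * ?C 2 * w ^ (m - 2) * (2 * t ^ 2)"
      unfolding c3 c5 im by (simp add: algebra_simps)
    also have "\<dots> = - S - (w ^ m - 1)"
      using L lehmer_poly_split[OF m2, of w "2 * t"] unfolding S_def[symmetric]
      by (simp add: numeral_2_eq_2 algebra_simps)
    finally have "2 ^ (e + 2) dvd 2 ^ (e + 1) * (int k * w ^ m + c3 * w ^ (m - 1) * t + c5 * w ^ (m - 2) * t ^ 2)"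
      using S w1 by simp
    then have "2 ^ (e + 1) * 2 dvd 2 ^ (e + 1) * (int k * w ^ m + c3 * w ^ (m - 1) * t + c5 * w ^ (m - 2) * t ^ 2)"
      by (simp add: mult.commute)
    then have "even (int k * w ^ m + c3 * w ^ (m - 1) * t + c5 * w ^ (m - 2) * t ^ 2)"
      by (subst (asm) dvd_times_left_cancel_iff) auto
    then show False using w c3(1) c5(1) m(2) assms(2) by simp
  qed
qed

section \<open>Homogeneous elements of the ring generated by the square roots of 3 and -2\<close>

text \<open>The elements \<open>a + b \<surd>-6\<close> (for \<^const>\<open>True\<close>) and \<open>a \<surd>3 + b \<surd>-2\<close> (for \<^const>\<open>False\<close>)
  are the two homogeneous parts of a ring graded by the group of order 2.  The class group of
  \<open>\<int>[\<surd>-6]\<close> has order 2, and the ideals of its nontrivial class become principal, generated by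
  elements \<open>a \<surd>3 + b \<surd>-2\<close>; so homogeneous elements prime to 6 factor uniquely even though \<open>\<int>[\<surd>-6]\<close> is not factorial.\<close>

definition quad :: "bool \<Rightarrow> int \<Rightarrow> int \<Rightarrow> complex" where
  "quad t a b = (if t then Complex (of_int a) (sqrt 6 * of_int b)
                else Complex (sqrt 3 * of_int a) (sqrt 2 * of_int b))"

definition Quad :: "bool \<Rightarrow> complex set" where
  "Quad t = {quad t a b | a b. True}"

definition quad_norm :: "bool \<Rightarrow> int \<Rightarrow> int \<Rightarrow> int" where
  "quad_norm t a b = (if t then a\<^sup>2 + 6 * b\<^sup>2 else 3 * a\<^sup>2 + 2 * b\<^sup>2)"

lemma sqrt_6_eq: "sqrt 6 = sqrt 3 * sqrt (2::real)"
  by (simp flip: real_sqrt_mult)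

lemma quad_mult:
  "quad True a b * quad True c e = quad True (a * c - 6 * b * e) (a * e + b * c)"
  "quad True a b * quad False c e = quad False (a * c - 2 * b * e) (a * e + 3 * b * c)"
  "quad False a b * quad True c e = quad False (a * c - 2 * b * e) (3 * a * e + b * c)"
  "quad False a b * quad False c e = quad True (3 * a * c - 2 * b * e) (a * e + b * c)"
  by (auto simp: quad_def complex_eq_iff sqrt_6_eq algebra_simps)

lemma quad_cnj: "cnj (quad t a b) = quad t a (- b)"
  by (simp add: quad_def complex_eq_iff)

lemma quad_inj: "quad t a b = quad t c e \<longleftrightarrow> a = c \<and> b = e"
  by (auto simp: quad_def complex_eq_iff)

lemma quad_mult_cnj: "quad t a b * cnj (quad t a b) = of_int (quad_norm t a b)"
  by (cases t) (auto simp: quad_def quad_norm_def complex_eq_iff power2_eq_square algebra_simps)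

lemma quad_scale: "quad t (k * a) (k * b) = of_int k * quad t a b"
  by (auto simp: quad_def complex_eq_iff)

text \<open>Equality of booleans is the operation of the grading group, with neutral element
  \<open>True\<close>. Accordingly the \<open>j\<close>-th power of an element of grade
  \<open>s\<close> has grade \<open>odd j \<longrightarrow> s\<close>.\<close>

lemma Quad_mult: "x \<in> Quad s \<Longrightarrow> y \<in> Quad t \<Longrightarrow> x * y \<in> Quad (s = t)"
  by (cases s; cases t) (force simp: Quad_def quad_mult)+

lemma one_in_Quad: "1 \<in> Quad True"
  unfolding Quad_def by (auto simp: quad_def complex_eq_iff intro!: exI[of _ 1] exI[of _ 0])

lemma Quad_power: "x \<in> Quad s \<Longrightarrow> x ^ j \<in> Quad (odd j \<longrightarrow> s)"
proof (induction j)
  case (Suc j)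
  then have "x * x ^ j \<in> Quad (s = (odd j \<longrightarrow> s))" by (intro Quad_mult)
  moreover have "(s = (odd j \<longrightarrow> s)) = (odd (Suc j) \<longrightarrow> s)" by auto
  ultimately show ?case by simp
qed (simp add: one_in_Quad)

section \<open>Primes represented by one of the two forms\<close>

lemma thue:
  fixes X Y :: int and q :: nat
  assumes "prime q"
  shows "\<exists>a b. (a, b) \<noteq> (0, 0) \<and> a\<^sup>2 < int q \<and> b\<^sup>2 < int q \<and> int q dvd a * Y - b * X"
proof -
  \<comment> \<open>The box has \<open>(k + 1)^2 > q\<close> points, so two of them share the
    residue of \<open>a * Y - b * X\<close>, and their difference is the desired pair. Its bounds
    are strict because a prime is not a square.\<close>
  define k where "k = floor_sqrt q"
  define S where "S = {0..int k} \<times> {0..int k}"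
  define f where "f = (\<lambda>(a, b). (a * Y - b * X) mod int q)"
  have q: "q > 0" using assms prime_gt_0_nat by blast
  have "card (f ` S) \<le> card {0..<int q}"
    using q by (intro card_mono) (auto simp: f_def)
  also have "\<dots> < (Suc k)\<^sup>2" unfolding k_def using Suc_floor_sqrt_power2_gt by simp
  also have "\<dots> = card S" by (simp add: S_def card_cartesian_product power2_eq_square nat_add_distrib)
  finally have "\<not> inj_on f S" by (rule pigeonhole)
  then obtain a b c e where *: "(a, b) \<in> S" "(c, e) \<in> S" "(a, b) \<noteq> (c, e)" "f (a, b) = f (c, e)"
    unfolding inj_on_def by (metis surj_pair)
  have less: "z\<^sup>2 < int q" if "\<bar>z\<bar> \<le> int k" for z
  proof -
    have "z\<^sup>2 \<le> (int k)\<^sup>2" using that by (metis abs_le_square_iff abs_of_nat)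
    also have "(int k)\<^sup>2 \<le> int q" unfolding k_def using floor_sqrt_power2_le[of q]
      by (metis of_nat_le_iff of_nat_power)
    finally have "z\<^sup>2 \<le> int q" .
    moreover have "z\<^sup>2 \<noteq> int q"
    proof
      assume "z\<^sup>2 = int q"
      then have "prime (z\<^sup>2)" using assms by simp
      then show False by (simp add: prime_power_iff)
    qed
    ultimately show ?thesis by simp
  qed
  have "int q dvd (a * Y - b * X) - (c * Y - e * X)"
    using *(4) unfolding f_def by (simp add: mod_eq_dvd_iff)
  then have "int q dvd (a - c) * Y - (b - e) * X" by (simp add: algebra_simps)
  moreover have "(a - c)\<^sup>2 < int q" "(b - e)\<^sup>2 < int q"
    using *(1,2) by (auto simp: S_def intro!: less)
  ultimately show ?thesis using *(3) by (intro exI[of _ "a - c"] exI[of _ "b - e"]) auto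
qed

lemma prime_not_dvd_prime:
  assumes "prime q" "prime r" "q \<noteq> r"
  shows "\<not> int q dvd int r"
  using assms primes_dvd_imp_eq by auto

text \<open>Thue's lemma gives \<open>a\<^sup>2 + 6 b\<^sup>2 = k q\<close> with \<open>0 < k < 7\<close>; each \<open>k\<close> is then removed by hand.\<close>

lemma prime_represented:
  fixes X Y :: int and q :: nat
  assumes "prime q" "q \<noteq> 3" "int q dvd quad_norm t X Y" "\<not> (int q dvd X \<and> int q dvd Y)" "q \<noteq> 2"
  shows "\<exists>s a b. quad_norm s a b = int q"
proof -
  have pq: "prime (int q)" using assms(1) by simp
  have nd: "\<not> int q dvd 3" "\<not> int q dvd 2" "\<not> int q dvd 6"
  proof -
    show 3: "\<not> int q dvd 3" using prime_not_dvd_prime[of q 3] assms(1,2) by simp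
    show 2: "\<not> int q dvd 2" using prime_not_dvd_prime[of q 2] assms(1,5) by simp
    show "\<not> int q dvd 6" using 2 3 prime_dvd_mult_iff[OF pq, of 2 3] by simp
  qed
  \<comment> \<open>Multiplication by 3 turns the second form into the first one at
    \<open>(3 * X, Y)\<close>; this creates no common factor because
    \<open>q \<noteq> 3\<close>.\<close>
  obtain X' where X': "int q dvd X'\<^sup>2 + 6 * Y\<^sup>2" "\<not> (int q dvd X' \<and> int q dvd Y)"
  proof (cases t)
    case True
    then show ?thesis using assms(3,4) that by (auto simp: quad_norm_def)
  next
    case False
    have "(3 * X)\<^sup>2 + 6 * Y\<^sup>2 = 3 * quad_norm t X Y" using False by (simp add: quad_norm_def)
    then have "int q dvd (3 * X)\<^sup>2 + 6 * Y\<^sup>2" using assms(3) by simp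
    moreover have "\<not> (int q dvd 3 * X \<and> int q dvd Y)"
      using assms(4) nd pq by (simp add: prime_dvd_mult_iff)
    ultimately show ?thesis using that by blast
  qed
  have Y: "\<not> int q dvd Y"
  proof
    assume "int q dvd Y"
    moreover from this have "int q dvd X'\<^sup>2"
      using X'(1) by (simp add: dvd_add_left_iff power2_eq_square)
    ultimately show False using X'(2) pq prime_dvd_power by blast
  qed
  obtain a b where ab: "(a, b) \<noteq> (0, 0)" "a\<^sup>2 < int q" "b\<^sup>2 < int q" "int q dvd a * Y - b * X'"
    using thue[OF assms(1)] by blast
  \<comment> \<open>Thue's pair is proportional to \<open>(X', Y)\<close> modulo \<open>q\<close>,
    so the form vanishes at it as well.\<close>
  have "Y\<^sup>2 * (a\<^sup>2 + 6 * b\<^sup>2) = (a * Y - b * X') * (a * Y + b * X') + b\<^sup>2 * (X'\<^sup>2 + 6 * Y\<^sup>2)"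
    by (simp add: power2_eq_square algebra_simps)
  then have "int q dvd Y\<^sup>2 * (a\<^sup>2 + 6 * b\<^sup>2)" using ab(4) X'(1) by simp
  then have "int q dvd a\<^sup>2 + 6 * b\<^sup>2"
    using Y pq by (metis prime_dvd_mult_iff prime_dvd_power)
  then obtain k where k: "a\<^sup>2 + 6 * b\<^sup>2 = int q * k" by blast
  have "a\<^sup>2 + 6 * b\<^sup>2 < int q * 7" using ab by simp
  then have "k < 7" using k by (simp add: mult_less_cancel_left)
  have "a\<^sup>2 + 6 * b\<^sup>2 > 0" using ab(1) by (cases "a = 0") (auto intro: add_pos_nonneg)
  then have "k > 0" unfolding k by (simp add: zero_less_mult_iff)
  then consider "k = 1" | "k = 2" | "k = 3" | "k = 4" | "k = 5" | "k = 6" using \<open>k < 7\<close> by linarith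
  then show ?thesis
  proof cases
    case 1
    then show ?thesis using k by (intro exI[of _ True] exI[of _ a] exI[of _ b]) (simp add: quad_norm_def)
  next
    case 2
    have "a\<^sup>2 = 2 * (int q - 3 * b\<^sup>2)" using k 2 by simp
    then have "even (a\<^sup>2)" by simp
    then obtain c where "a = 2 * c" by (auto elim: evenE)
    then show ?thesis using k 2
      by (intro exI[of _ False] exI[of _ b] exI[of _ c]) (simp add: quad_norm_def)
  next
    case 3
    have "a\<^sup>2 = 3 * (int q - 2 * b\<^sup>2)" using k 3 by simp
    then have "3 dvd a\<^sup>2" by simp
    then have "3 dvd a" by (rule prime_dvd_power[rotated]) simp
    then obtain c where "a = 3 * c" by blast
    then show ?thesis using k 3
      by (intro exI[of _ False] exI[of _ c] exI[of _ b]) (simp add: quad_norm_def)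
  next
    case 4
    have "a\<^sup>2 = 2 * (2 * int q - 3 * b\<^sup>2)" using k 4 by simp
    then have "even (a\<^sup>2)" by simp
    then obtain c where c: "a = 2 * c" by (auto elim: evenE)
    then have "3 * b\<^sup>2 = 2 * (int q - c\<^sup>2)" using k 4 by simp
    then have "even (3 * b\<^sup>2)" by simp
    then obtain e where "b = 2 * e" by (auto elim: evenE)
    then show ?thesis using k 4 c
      by (intro exI[of _ True] exI[of _ c] exI[of _ e]) (simp add: quad_norm_def)
  next
    case 5
    \<comment> \<open>Modulo 5 the form is \<open>a\<^sup>2 - 4 * b\<^sup>2\<close>, which splits.
      Each linear factor leads to \<open>q\<close> being 3 times a square plus 2 times a
      square.\<close>
    have "(a - 2 * b) * (a + 2 * b) = 5 * (int q - 2 * b\<^sup>2)"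
      using k 5 by (simp add: power2_eq_square algebra_simps)
    then have "5 dvd (a - 2 * b) * (a + 2 * b)" by simp
    then have "5 dvd a - 2 * b \<or> 5 dvd a + 2 * b" by (simp add: prime_dvd_mult_iff)
    then show ?thesis
    proof
      assume "5 dvd a - 2 * b"
      then obtain c where "a = 2 * b + 5 * c" by (metis dvdE diff_eq_eq add.commute)
      then show ?thesis using k 5
        by (intro exI[of _ False] exI[of _ c] exI[of _ "b + c"]) (simp add: quad_norm_def power2_eq_square algebra_simps)
    next
      assume "5 dvd a + 2 * b"
      then obtain c where "a = 5 * c - 2 * b" by (metis dvdE add_diff_cancel_right')
      then have "(5 * c - 2 * b)\<^sup>2 + 6 * b\<^sup>2 = int q * 5" using k 5 by simp
      then show ?thesis
        by (intro exI[of _ False] exI[of _ c] exI[of _ "b - c"]) (simp add: quad_norm_def power2_eq_square algebra_simps)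
    qed
  next
    case 6
    have "a\<^sup>2 = 6 * (int q - b\<^sup>2)" using k 6 by simp
    then have "even (a\<^sup>2)" "3 dvd a\<^sup>2" by simp_all
    then have "even a" "3 dvd a" by (auto intro: prime_dvd_power[of 3 a 2])
    then have "6 dvd a" by presburger
    then obtain c where "a = 6 * c" by blast
    then show ?thesis using k 6
      by (intro exI[of _ True] exI[of _ b] exI[of _ c]) (simp add: quad_norm_def)
  qed
qed

section \<open>Unique factorization of homogeneous elements\<close>

lemma quad_div_in_Quad:
  assumes "prime q" "q \<noteq> 2" "q \<noteq> 3" "int q dvd quad_norm t R I" "int q dvd I"
  shows "quad t R I / of_nat q \<in> Quad t"
proof -
  have pq: "prime (int q)" using assms(1) by simp
  have 3: "\<not> int q dvd 3" using prime_not_dvd_prime[of q 3] assms(1,3) by simp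
  obtain i where i: "I = int q * i" using assms(5) by blast
  have "int q dvd I\<^sup>2" using assms(5) by (simp add: power2_eq_square)
  then have "int q dvd (if t then R\<^sup>2 else 3 * R\<^sup>2)"
    using assms(4) by (auto simp: quad_norm_def dvd_add_left_iff)
  then have "int q dvd R" using 3 pq by (auto split: if_splits simp: prime_dvd_mult_iff intro: prime_dvd_power)
  then obtain r where r: "R = int q * r" by blast
  have "quad t R I / of_nat q = quad t r i"
    using assms(1) by (simp add: r i quad_scale)
  then show ?thesis unfolding Quad_def by blast
qed

text \<open>The second coordinates of \<open>z * cnj p\<close> and \<open>z * p\<close> have a
  product divisible by \<open>q\<close>, being up to factors 3 a combination of both norms. So
  \<open>q\<close> divides one of them; both elements have norm \<open>N * q\<close>, hence
  \<open>q\<close> divides that whole element. Dividing by \<open>q = p * cnj p\<close> gives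
  \<open>z / p\<close> or \<open>z / cnj p\<close>.\<close>

lemma Quad_prime_factor:
  assumes q: "prime q" "q \<noteq> 2" "q \<noteq> 3" and z: "z \<in> Quad t" "z * cnj z = of_int N" "int q dvd N"
    and p: "p \<in> Quad s" "p * cnj p = of_nat q"
  shows "z / p \<in> Quad (t = s) \<or> z / cnj p \<in> Quad (t = s)"
proof -
  obtain X Y where X: "z = quad t X Y" using z(1) unfolding Quad_def by blast
  obtain a b where a: "p = quad s a b" using p(1) unfolding Quad_def by blast
  have N: "N = quad_norm t X Y" using z(2) unfolding X quad_mult_cnj by simp
  have Q: "quad_norm s a b = int q"
    using p(2) unfolding a quad_mult_cnj by (metis of_int_eq_iff of_int_of_nat_eq)
  have pq: "prime (int q)" using q(1) by simp
  have 3: "\<not> int q dvd 3" using prime_not_dvd_prime[of q 3] q(1,3) by simp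
  have p0: "p \<noteq> 0" using p(2) q(1) by auto
  obtain R I R' I' where RI: "z * cnj p = quad (t = s) R I" "z * p = quad (t = s) R' I'" "int q dvd I * I'"
  proof (cases t; cases s)
    assume ts: t s
    have "(Y * a - X * b) * (Y * a + X * b) = Y\<^sup>2 * quad_norm s a b - b\<^sup>2 * quad_norm t X Y"
      by (simp add: quad_norm_def ts power2_eq_square algebra_simps)
    then have "int q dvd (Y * a - X * b) * (Y * a + X * b)" using Q z(3) N by simp
    with that[of "X * a + 6 * Y * b" "Y * a - X * b" "X * a - 6 * Y * b" "Y * a + X * b"]
    show ?thesis using ts by (simp add: X a quad_cnj quad_mult algebra_simps)
  next
    assume ts: t "\<not> s"
    have "(3 * Y * a - X * b) * (3 * Y * a + X * b) = 3 * Y\<^sup>2 * quad_norm s a b - b\<^sup>2 * quad_norm t X Y"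
      by (simp add: quad_norm_def ts power2_eq_square algebra_simps)
    then have "int q dvd (3 * Y * a - X * b) * (3 * Y * a + X * b)" using Q z(3) N by simp
    with that[of "X * a + 2 * Y * b" "3 * Y * a - X * b" "X * a - 2 * Y * b" "3 * Y * a + X * b"]
    show ?thesis using ts by (simp add: X a quad_cnj quad_mult algebra_simps)
  next
    assume ts: "\<not> t" s
    have "(Y * a - 3 * X * b) * (Y * a + 3 * X * b) = Y\<^sup>2 * quad_norm s a b - 3 * b\<^sup>2 * quad_norm t X Y"
      by (simp add: quad_norm_def ts power2_eq_square algebra_simps)
    then have "int q dvd (Y * a - 3 * X * b) * (Y * a + 3 * X * b)" using Q z(3) N by simp
    with that[of "X * a + 2 * Y * b" "Y * a - 3 * X * b" "X * a - 2 * Y * b" "Y * a + 3 * X * b"]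
    show ?thesis using ts by (simp add: X a quad_cnj quad_mult algebra_simps)
  next
    assume ts: "\<not> t" "\<not> s"
    have "3 * ((Y * a - X * b) * (Y * a + X * b)) = Y\<^sup>2 * quad_norm s a b - b\<^sup>2 * quad_norm t X Y"
      by (simp add: quad_norm_def ts power2_eq_square algebra_simps)
    then have "int q dvd 3 * ((Y * a - X * b) * (Y * a + X * b))" using Q z(3) N by simp
    then have "int q dvd (Y * a - X * b) * (Y * a + X * b)"
      using 3 pq prime_dvd_mult_iff by blast
    with that[of "3 * X * a + 2 * Y * b" "Y * a - X * b" "3 * X * a - 2 * Y * b" "Y * a + X * b"]
    show ?thesis using ts by (simp add: X a quad_cnj quad_mult algebra_simps)
  qed
  have norm_mult: "z * cnj p * (cnj z * p) = z * cnj z * (p * cnj p)"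
    "z * p * (cnj z * cnj p) = z * cnj z * (p * cnj p)" by (simp_all add: mult_ac)
  have "of_int (quad_norm (t = s) R I) = z * cnj p * cnj (z * cnj p)"
    unfolding RI(1) quad_mult_cnj ..
  also have "\<dots> = of_int (N * int q)" using z(2) p(2) by (simp add: norm_mult)
  finally have F1: "quad_norm (t = s) R I = N * int q" by (simp only: of_int_eq_iff)
  have "of_int (quad_norm (t = s) R' I') = z * p * cnj (z * p)"
    unfolding RI(2) quad_mult_cnj ..
  also have "\<dots> = of_int (N * int q)" using z(2) p(2) by (simp add: norm_mult)
  finally have F2: "quad_norm (t = s) R' I' = N * int q" by (simp only: of_int_eq_iff)
  have "z * cnj p / of_nat q \<in> Quad (t = s) \<or> z * p / of_nat q \<in> Quad (t = s)"
    using RI(3) pq quad_div_in_Quad[OF q, of "t = s" R I] quad_div_in_Quad[OF q, of "t = s" R' I']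
    by (auto simp: RI(1,2) F1 F2 prime_dvd_mult_iff)
  moreover have "z * cnj p / of_nat q = z / p" "z * p / of_nat q = z / cnj p"
    using p0 by (auto simp flip: p(2))
  ultimately show ?thesis by simp
qed

text \<open>If after some factors \<open>p\<close> the conjugate of \<open>p\<close> split off, \<open>z\<close> would be divisible by \<open>q\<close>.\<close>

lemma Quad_prime_power_factor:
  assumes q: "prime q" "q \<noteq> 2" "q \<noteq> 3" and z: "z \<in> Quad t" "z * cnj z = of_nat (q ^ n * M)"
    and p: "p \<in> Quad s" "p * cnj p = of_nat q" and "z / p \<in> Quad (t = s)" "z / of_nat q \<notin> Quad t"
    and "j \<le> n"
  shows "z / p ^ j \<in> Quad (t = (odd j \<longrightarrow> s))"
  using \<open>j \<le> n\<close>
proof (induction j)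
  case 0
  then show ?case using z(1) by simp
next
  case (Suc j)
  define B where "B = z / p ^ j"
  have p0: "p \<noteq> 0" using p(2) q(1) by auto
  have B: "B \<in> Quad (t = (odd j \<longrightarrow> s))" using Suc unfolding B_def by simp
  show ?case
  proof (cases "j = 0")
    case True
    then show ?thesis using assms(8) by simp
  next
    case False
    obtain i where i: "n = j + i" "i > 0"
      using Suc.prems by (metis less_imp_add_positive Suc_le_eq)
    have "B * cnj B = of_nat (q ^ n * M) / (p * cnj p) ^ j"
      unfolding z(2)[symmetric] by (simp add: B_def power_mult_distrib)
    also have "\<dots> = of_int (int (q ^ i * M))"
      using q(1) by (simp add: p(2) i(1) power_add)
    finally have "B * cnj B = of_int (int (q ^ i * M))" .
    moreover have "int q dvd int (q ^ i * M)"
      using i(2) by simp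
    ultimately have "B / p \<in> Quad ((t = (odd j \<longrightarrow> s)) = s) \<or> B / cnj p \<in> Quad ((t = (odd j \<longrightarrow> s)) = s)"
      using Quad_prime_factor[OF q B _ _ p] by blast
    moreover have "B / cnj p \<notin> Quad ((t = (odd j \<longrightarrow> s)) = s)"
    proof
      assume "B / cnj p \<in> Quad ((t = (odd j \<longrightarrow> s)) = s)"
      then have "p ^ (j - 1) * (B / cnj p) \<in> Quad ((odd (j - 1) \<longrightarrow> s) = ((t = (odd j \<longrightarrow> s)) = s))"
        by (intro Quad_mult Quad_power p(1))
      moreover have "((odd (j - 1) \<longrightarrow> s) = ((t = (odd j \<longrightarrow> s)) = s)) = t"
        using False by auto
      moreover have "p ^ (j - 1) * (B / cnj p) = z / (p * cnj p)"
        using False p0 unfolding B_def by (cases j) auto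
      ultimately show False using assms(9) p(2) by simp
    qed
    moreover have "((t = (odd j \<longrightarrow> s)) = s) = (t = (odd (Suc j) \<longrightarrow> s))" by auto
    moreover have "B / p = z / p ^ Suc j" by (simp add: B_def mult.commute)
    ultimately show ?thesis by simp
  qed
qed

text \<open>Induction on \<open>y\<close>: a prime \<open>q\<close> dividing \<open>y\<close> is the
  norm of some \<open>p\<close> dividing \<open>z\<close>, primitivity of \<open>z\<close> makes
  \<open>p ^ n\<close> divide \<open>z\<close>, and the quotient has norm
  \<open>(y / q) ^ n\<close>. For \<open>y = 1\<close> only 1 and -1 remain, which are their own
  \<open>n\<close>-th powers since \<open>n\<close> is odd.\<close>

lemma Quad_nth_root:
  assumes "odd n" "z \<in> Quad t" "z * cnj z = of_nat (y ^ n)" "coprime y 6" "y > 0"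
    and "\<And>q. prime q \<Longrightarrow> z / of_nat q \<notin> Quad t"
  shows "\<exists>g\<in>Quad t. z = g ^ n"
  using assms(2-)
proof (induction y arbitrary: z t rule: less_induct)
  case (less y)
  obtain X Y where X: "z = quad t X Y" using less.prems(1) unfolding Quad_def by blast
  have N: "quad_norm t X Y = int y ^ n"
    using less.prems(2) unfolding X quad_mult_cnj by (metis of_int_eq_iff of_int_of_nat_eq of_nat_power)
  show ?case
  proof (cases "y = 1")
    case True
    have t: t
    proof (rule ccontr)
      assume "\<not> t"
      then have *: "3 * X\<^sup>2 + 2 * Y\<^sup>2 = 1" using N True by (simp add: quad_norm_def)
      have "X = 0"
      proof (rule ccontr)
        assume "X \<noteq> 0"
        then have "X\<^sup>2 > 0" by simp
        then show False using * zero_le_power2[of Y] by linarith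
      qed
      with * have "2 * Y\<^sup>2 = 1" by simp
      then show False by presburger
    qed
    then have *: "X\<^sup>2 + 6 * Y\<^sup>2 = 1" using N True by (simp add: quad_norm_def)
    have "Y = 0"
    proof (rule ccontr)
      assume "Y \<noteq> 0"
      then have "Y\<^sup>2 > 0" by simp
      then show False using * zero_le_power2[of X] by linarith
    qed
    with * have "X = 1 \<or> X = -1" by (simp add: power2_eq_1_iff)
    then have "z = 1 \<or> z = -1" using t \<open>Y = 0\<close> by (auto simp: X quad_def complex_eq_iff)
    then have "z = z ^ n" using assms(1) by auto
    then show ?thesis using less.prems(1) by blast
  next
    case False
    then obtain q where q: "prime q" "q dvd y" using prime_factor_nat by blast
    have q23: "q \<noteq> 2" "q \<noteq> 3"
      using q(2) less.prems(3) by (auto dest: coprime_common_divisor)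
    obtain y' where y': "y = q * y'" using q(2) by blast
    have n: "n > 0" using assms(1) by (cases n) auto
    have "\<not> (int q dvd X \<and> int q dvd Y)"
    proof
      assume "int q dvd X \<and> int q dvd Y"
      then obtain i j where "X = int q * i" "Y = int q * j" by (auto elim!: dvdE)
      then have "z / of_nat q = quad t i j" using q(1) by (simp add: X quad_scale)
      then show False using less.prems(5)[OF q(1)] unfolding Quad_def by blast
    qed
    moreover have qN: "int q dvd quad_norm t X Y" unfolding N using q(2) n
      by (meson dvd_power dvd_trans of_nat_dvd_iff dvd_power_le dvd_refl)
    ultimately obtain s a b where "quad_norm s a b = int q"
      using prime_represented[OF q(1) q23(2)] q23(1) by blast
    then have p0: "quad s a b * cnj (quad s a b) = of_nat q" "quad s a b \<in> Quad s" "cnj (quad s a b) \<in> Quad s"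
      unfolding quad_mult_cnj by (auto simp: Quad_def quad_cnj)
    have "z * cnj z = of_int (quad_norm t X Y)" by (simp add: X quad_mult_cnj)
    \<comment> \<open>Of the represented element and its conjugate, \<open>p\<close> is one that
      divides \<open>z\<close>.\<close>
    from Quad_prime_factor[OF q(1) q23 less.prems(1) this qN p0(2,1)] p0
    obtain p where p: "p \<in> Quad s" "p * cnj p = of_nat q" "z / p \<in> Quad (t = s)"
      by (metis complex_cnj_cnj mult.commute)
    have pn0: "p \<noteq> 0" using p(2) q(1) by auto
    define w where "w = z / p ^ n"
    have "z * cnj z = of_nat (q ^ n * y' ^ n)" using less.prems(2) by (simp add: y' power_mult_distrib)
    from Quad_prime_power_factor[OF q(1) q23 less.prems(1) this p less.prems(5)[OF q(1)] order_refl]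
    have w: "w \<in> Quad (t = s)" using assms(1) by (simp add: w_def)
    have pn: "p ^ n \<in> Quad s" using Quad_power[OF p(1), of n] assms(1) by simp
    have st: "(s = (t = s)) = t" by auto
    have "\<exists>g\<in>Quad (t = s). w = g ^ n"
    proof (rule less.IH[of y'])
      show "y' < y" using y' q(1) less.prems(4) prime_gt_1_nat[OF q(1)] by simp
      show "w * cnj w = of_nat (y' ^ n)"
      proof -
        have "w * cnj w = z * cnj z / (p * cnj p) ^ n" by (simp add: w_def power_mult_distrib)
        also have "\<dots> = of_nat (y' ^ n)" using q(1)
          by (simp add: less.prems(2) p(2) y' power_mult_distrib)
        finally show ?thesis .
      qed
      show "coprime y' 6" using less.prems(3) y' by simp
      show "y' > 0" using less.prems(4) y' by simp
      show "w / of_nat r \<notin> Quad (t = s)" if "prime r" for r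
      proof
        assume "w / of_nat r \<in> Quad (t = s)"
        from Quad_mult[OF pn this] have "p ^ n * (w / of_nat r) \<in> Quad t" unfolding st .
        moreover have "p ^ n * (w / of_nat r) = z / of_nat r" using pn0 unfolding w_def by simp
        ultimately show False using less.prems(5)[OF that] by metis
      qed
    qed (rule w)
    then obtain g where g: "g \<in> Quad (t = s)" "w = g ^ n" by blast
    have "p * g \<in> Quad t" using Quad_mult[OF p(1) g(1)] unfolding st .
    moreover have "z = (p * g) ^ n" using g(2) pn0 by (simp add: w_def power_mult_distrib field_simps)
    ultimately show ?thesis by blast
  qed
qed

section \<open>The Diophantine equation\<close>

lemma odd_power_add:
  fixes a b :: "'a :: comm_semiring_1"
  shows "(a + b) ^ (2 * m + 1) =
    a * (\<Sum>j\<le>m. of_nat (2 * m + 1 choose (2 * j)) * (a\<^sup>2) ^ (m - j) * (b\<^sup>2) ^ j) +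
    b * (\<Sum>j\<le>m. of_nat (2 * m + 1 choose (2 * j + 1)) * (a\<^sup>2) ^ (m - j) * (b\<^sup>2) ^ j)"
proof -
  let ?f = "\<lambda>k. of_nat (2 * m + 1 choose k) * b ^ k * a ^ (2 * m + 1 - k)"
  have "(a + b) ^ (2 * m + 1) = (\<Sum>k\<le>Suc (2 * m). ?f k)"
    using binomial_ring[of b a "2 * m + 1"] by (simp add: add.commute)
  also have "\<dots> = (\<Sum>j\<le>m. ?f (2 * j)) + (\<Sum>j\<le>m. ?f (Suc (2 * j)))"
    by (simp only: sum.in_pairs_0 sum.distrib)
  also have "(\<Sum>j\<le>m. ?f (2 * j)) =
      a * (\<Sum>j\<le>m. of_nat (2 * m + 1 choose (2 * j)) * (a\<^sup>2) ^ (m - j) * (b\<^sup>2) ^ j)"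
    unfolding sum_distrib_left
  proof (rule sum.cong)
    fix j assume "j \<in> {..m}"
    then have "2 * m + 1 - 2 * j = Suc (2 * (m - j))" by auto
    then show "?f (2 * j) = a * (of_nat (2 * m + 1 choose (2 * j)) * (a\<^sup>2) ^ (m - j) * (b\<^sup>2) ^ j)"
      by (simp only: power_Suc power_mult) (simp only: mult_ac)
  qed simp
  also have "(\<Sum>j\<le>m. ?f (Suc (2 * j))) =
      b * (\<Sum>j\<le>m. of_nat (2 * m + 1 choose (2 * j + 1)) * (a\<^sup>2) ^ (m - j) * (b\<^sup>2) ^ j)"
    unfolding sum_distrib_left
  proof (rule sum.cong)
    fix j assume "j \<in> {..m}"
    then have "2 * m + 1 - Suc (2 * j) = 2 * (m - j)" by auto
    then show "?f (Suc (2 * j)) = b * (of_nat (2 * m + 1 choose (2 * j + 1)) * (a\<^sup>2) ^ (m - j) * (b\<^sup>2) ^ j)"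
      by (simp only: power_Suc power_mult Suc_eq_plus1[symmetric]) (simp only: mult_ac)
  qed simp
  finally show ?thesis .
qed

text \<open>The two summands \<open>u \<surd>3\<close> and \<open>v \<surd>-2\<close> have integer
  squares, so the binomial expansion splits by parity. Of \<open>S\<close> only integrality matters:
  it yields \<open>u dvd x\<close> later.\<close>

lemma quad_False_odd_power:
  obtains S where "quad False u v ^ (2 * m + 1)
    = quad False (u * S) (v * lehmer_poly m (3 * u\<^sup>2) (- 2 * v\<^sup>2))"
proof
  define a b where "a = quad False u 0" and "b = quad False 0 v"
  define S where "S = (\<Sum>j\<le>m. int (2 * m + 1 choose (2 * j)) * (3 * u\<^sup>2) ^ (m - j) * (- 2 * v\<^sup>2) ^ j)"
  have ab: "quad False u v = a + b"
    by (simp add: a_def b_def quad_def complex_eq_iff)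
  have sq: "a\<^sup>2 = of_int (3 * u\<^sup>2)" "b\<^sup>2 = of_int (- 2 * v\<^sup>2)"
    by (auto simp: a_def b_def quad_def complex_eq_iff power2_eq_square algebra_simps)
  have "quad False u v ^ (2 * m + 1) = a * of_int S + b * of_int (lehmer_poly m (3 * u\<^sup>2) (- 2 * v\<^sup>2))"
    unfolding ab odd_power_add sq S_def lehmer_poly_def by simp
  also have "\<dots> = quad False (u * S) (v * lehmer_poly m (3 * u\<^sup>2) (- 2 * v\<^sup>2))"
    by (simp add: a_def b_def quad_def complex_eq_iff)
  finally show "quad False u v ^ (2 * m + 1) = quad False (u * S) (v * lehmer_poly m (3 * u\<^sup>2) (- 2 * v\<^sup>2))" .
qed

text \<open>An even \<open>y\<close> would make \<open>x\<close> even. If 3 divided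
  \<open>d\<close>, it would divide \<open>y\<close>, so 9 would divide \<open>y ^ n\<close> and
  \<open>d\<^sup>2\<close>, hence \<open>3 * x\<^sup>2\<close>, and 3 would divide both
  \<open>x\<close> and \<open>y\<close>.\<close>

lemma solution_coprime:
  fixes x y d :: int
  assumes "3 * x\<^sup>2 + 2 * d\<^sup>2 = y ^ n" "coprime x y" "n \<ge> 3"
  shows "coprime x d" "\<not> 3 dvd d" "odd y" "\<not> 3 dvd y"
proof -
  show "coprime x d"
  proof (rule coprimeI)
    fix g assume g: "g dvd x" "g dvd d"
    then have "g dvd y ^ n" unfolding assms(1)[symmetric] by (simp add: power2_eq_square)
    moreover have "coprime x (y ^ n)" using assms(2) by simp
    ultimately show "is_unit g" using g(1) coprime_common_divisor by blast
  qed
  show odd: "odd y"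
  proof
    assume "even y"
    moreover from this have "even (y ^ n)" using assms(3) by simp
    then have "even (3 * x\<^sup>2)" unfolding assms(1)[symmetric] by presburger
    then have "even x" by simp
    ultimately show False using assms(2) by (auto dest: coprime_common_divisor)
  qed
  show "\<not> 3 dvd d"
  proof
    assume d: "3 dvd d"
    then have "3 dvd 2 * d\<^sup>2" by (simp add: power2_eq_square)
    then have "3 dvd y ^ n" unfolding assms(1)[symmetric] by simp
    then have y: "3 dvd y" by (rule prime_dvd_power[rotated]) simp
    then have "3 ^ n dvd y ^ n" by (rule dvd_power_same)
    moreover have "(3::int) ^ 2 dvd 3 ^ n" using assms(3) by (intro le_imp_power_dvd) simp
    ultimately have "3\<^sup>2 dvd y ^ n" by (rule dvd_trans[rotated])
    moreover have "3\<^sup>2 dvd d\<^sup>2" using d by (rule dvd_power_same)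
    then have "3\<^sup>2 dvd 2 * d\<^sup>2" by (rule dvd_mult)
    ultimately have "3\<^sup>2 dvd 3 * x\<^sup>2" unfolding assms(1)[symmetric]
      by (simp only: dvd_add_left_iff)
    then have "3 * 3 dvd 3 * x\<^sup>2" by simp
    then have "3 dvd x\<^sup>2" by (subst (asm) dvd_times_left_cancel_iff) simp_all
    then have "3 dvd x" by (rule prime_dvd_power[rotated]) simp
    with y show False using assms(2) coprime_common_divisor[of x y 3] by auto
  qed
  then show "\<not> 3 dvd y"
  proof (rule contrapos_nn)
    assume "3 dvd y"
    moreover have "y dvd y ^ n" using assms(3) by (intro dvd_power) simp
    ultimately have "3 dvd y ^ n" by (rule dvd_trans)
    then have "3 dvd 2 * d\<^sup>2" unfolding assms(1)[symmetric] by presburger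
    then have "3 dvd d\<^sup>2" by presburger
    then show "3 dvd d" by (rule prime_dvd_power[rotated]) simp
  qed
qed

lemma solution_parametrized:
  fixes x y d :: int
  assumes eq: "3 * x\<^sup>2 + 2 * d\<^sup>2 = y ^ n" and "coprime x y" "n = 2 * m + 1" "m \<ge> 1" "y > 0"
  obtains u v where "u dvd x" "y = 3 * u\<^sup>2 + 2 * v\<^sup>2" "d = v * lehmer_poly m (3 * u\<^sup>2) (- 2 * v\<^sup>2)"
proof -
  have n3: "n \<ge> 3" using assms(3,4) by simp
  note sc = solution_coprime[OF eq assms(2) n3]
  define z where "z = quad False x d"
  have "\<exists>g\<in>Quad False. z = g ^ n"
  proof (rule Quad_nth_root)
    show "odd n" using assms(3) by simp
    show "z \<in> Quad False" unfolding Quad_def z_def by blast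
    show "z * cnj z = of_nat (nat y ^ n)"
      unfolding z_def quad_mult_cnj using assms(5) eq by (simp add: quad_norm_def)
    have "\<not> 2 dvd nat y" "\<not> 3 dvd nat y"
      using sc(3,4) assms(5) int_dvd_int_iff[of 2 "nat y"] int_dvd_int_iff[of 3 "nat y"] by auto
    then have "coprime 2 (nat y)" "coprime 3 (nat y)"
      by (auto intro: prime_imp_coprime)
    then have "coprime (2 * 3) (nat y)" by (simp only: coprime_mult_left_iff)
    then show "coprime (nat y) 6" by (simp add: coprime_commute)
    show "nat y > 0" using assms(5) by simp
    show "z / of_nat q \<notin> Quad False" if "prime q" for q
    proof
      assume "z / of_nat q \<in> Quad False"
      then obtain a b where "z / of_nat q = quad False a b" unfolding Quad_def by blast
      then have "z = of_int (int q) * quad False a b" using that by (auto simp: field_simps)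
      then have "x = int q * a" "d = int q * b"
        unfolding z_def quad_scale[symmetric] quad_inj by auto
      then have "is_unit (int q)" using sc(1) coprime_common_divisor[of x d "int q"] by simp
      then show False using that by simp
    qed
  qed
  then obtain u v where g: "quad False x d = quad False u v ^ n" unfolding Quad_def z_def by blast
  obtain S where "quad False u v ^ n = quad False (u * S) (v * lehmer_poly m (3 * u\<^sup>2) (- 2 * v\<^sup>2))"
    using quad_False_odd_power assms(3) by metis
  then have xd: "x = u * S" "d = v * lehmer_poly m (3 * u\<^sup>2) (- 2 * v\<^sup>2)"
    unfolding g[symmetric] quad_inj by auto
  \<comment> \<open>Norms turn the \<open>n\<close>-th power into an equation between
    \<open>n\<close>-th powers of nonnegative integers, which gives \<open>y\<close>.\<close>
  have "complex_of_int (y ^ n) = quad False x d * cnj (quad False x d)"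
    unfolding quad_mult_cnj by (simp add: quad_norm_def eq[symmetric])
  also have "\<dots> = (quad False u v * cnj (quad False u v)) ^ n"
    unfolding g by (simp add: power_mult_distrib)
  also have "\<dots> = complex_of_int ((3 * u\<^sup>2 + 2 * v\<^sup>2) ^ n)"
    unfolding quad_mult_cnj by (simp add: quad_norm_def)
  finally have "y ^ n = (3 * u\<^sup>2 + 2 * v\<^sup>2) ^ n" by (simp only: of_int_eq_iff)
  then have "y = 3 * u\<^sup>2 + 2 * v\<^sup>2"
    by (rule power_eq_imp_eq_base) (use assms(5) n3 in auto)
  with xd that[of u v] show ?thesis by simp
qed

lemma odd_square_mod_4:
  fixes u :: int
  assumes "odd u"
  shows "u\<^sup>2 mod 4 = 1"
proof -
  obtain k where "u = 2 * k + 1" using assms by (metis oddE)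
  then have "u\<^sup>2 = 1 + 4 * (k\<^sup>2 + k)" by (simp add: power2_eq_square algebra_simps)
  then show ?thesis by (simp only: mod_mult_self2) simp
qed

section \<open>Determination of the absolute value of \<open>v\<close> and uniqueness\<close>

lemma dvd_prime_power_not_dvd:
  fixes k :: int and p r :: nat
  assumes "prime p" "k dvd int p ^ r" "\<not> int p dvd k"
  shows "\<bar>k\<bar> = 1"
proof -
  have "coprime (int p) k" using assms(1,3) by (intro prime_imp_coprime) auto
  then have "coprime (int p ^ r) k" by simp
  from coprime_common_divisor[OF this assms(2) dvd_refl] have "is_unit k" .
  then show ?thesis by simp
qed

lemma lehmer_poly_param_mod_3:
  assumes "\<not> 3 dvd v"
  shows "lehmer_poly m (3 * u) (- 2 * v\<^sup>2) mod 3 = 1"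
proof (rule lehmer_poly_mod_3)
  have "v mod 3 = 1 \<or> v mod 3 = 2" using assms by presburger
  then have "(v mod 3)\<^sup>2 mod 3 = 1" by (elim disjE; simp only:; simp)
  then have "v\<^sup>2 mod 3 = 1" by (simp only: power_mod)
  moreover have "- 2 * v\<^sup>2 = v\<^sup>2 + 3 * - (v\<^sup>2)" by simp
  ultimately show "- 2 * v\<^sup>2 mod 3 = 1" by (simp only: mod_mult_self2)
qed simp

lemma abs_param_eq:
  fixes u v :: int and p r m :: nat
  defines "L \<equiv> lehmer_poly m (3 * u\<^sup>2) (- 2 * v\<^sup>2)"
  assumes d: "int p ^ r = v * L" and p: "prime p" "r > 0" "\<not> 3 dvd int p ^ r"
    and u: "odd u" "\<not> int p dvd u" and m: "prime (2 * m + 1)" "m \<ge> 1"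
  shows "\<bar>v\<bar> = (if p = 2 then int p ^ r else if p = 2 * m + 1 then int p ^ (r - 1) else 1)"
proof -
  have pi: "prime (int p)" using p(1) by simp
  have p3: "p \<noteq> 3" using p(2,3) by auto
  then have np3: "\<not> int p dvd 3" using prime_not_dvd_prime[of p 3] p(1) by simp
  then have w: "\<not> int p dvd (3 * u\<^sup>2) ^ m"
    using pi u(2) by (auto simp: prime_dvd_mult_iff dest!: prime_dvd_power[rotated])
  have Ld: "L dvd int p ^ r" "v dvd int p ^ r" using d by auto
  show ?thesis
  proof (cases "p = 2")
    case True
    have "2 dvd L - int (2 * m + 1) * (3 * u\<^sup>2) ^ m"
      unfolding L_def by (intro dvd_lehmer_poly_minus_lead) simp
    then have "odd L" using u(1) by simp
    then have "\<bar>L\<bar> = 1" using Ld(1) p(1) True by (intro dvd_prime_power_not_dvd[of p]) auto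
    then have "\<bar>v\<bar> = \<bar>v * L\<bar>" by (simp add: abs_mult)
    then show ?thesis using True by (simp flip: d)
  next
    case False
    have "odd p" using False p(1) prime_odd_nat prime_ge_2_nat[OF p(1)] by auto
    then have "odd v" using Ld(2) by (metis dvd_trans even_of_nat even_power)
    have np2: "\<not> int p dvd 2" using prime_not_dvd_prime[of p 2] p(1) False by simp
    \<comment> \<open>Otherwise \<open>L\<close> is 1 or -1; the residue modulo 3 leaves 1, which
      \<open>lehmer_poly_ne_1\<close> excludes as \<open>u\<close> and \<open>v\<close> are
      odd.\<close>
    have pL: "int p dvd L"
    proof (rule ccontr)
      assume "\<not> int p dvd L"
      then have "\<bar>L\<bar> = 1" by (rule dvd_prime_power_not_dvd[OF p(1) Ld(1)])
      moreover have "\<not> 3 dvd v" using d p(3) by auto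
      then have "L mod 3 = 1" unfolding L_def by (rule lehmer_poly_param_mod_3)
      moreover have "L = 1 \<or> L = - 1" using \<open>\<bar>L\<bar> = 1\<close> by linarith
      ultimately have "L = 1" by auto
      moreover have "L \<noteq> 1"
        using lehmer_poly_ne_1[of "3 * u\<^sup>2" "- (v\<^sup>2)" m] odd_square_mod_4[OF u(1)] \<open>odd v\<close> m(2)
          mod_mult_right_eq[of 3 "u\<^sup>2" 4]
        unfolding L_def by simp
      ultimately show False by blast
    qed
    show ?thesis
    proof (cases "p = 2 * m + 1")
      case n: True
      \<comment> \<open>The last term of \<open>L\<close> forces \<open>p\<close> to divide
        \<open>v\<close>. Then modulo \<open>p\<^sup>2\<close> only the leading term
        \<open>p * (3 * u\<^sup>2) ^ m\<close> survives, so \<open>p\<close> divides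
        \<open>L\<close> exactly once.\<close>
      have "int p dvd L - (- 2 * v\<^sup>2) ^ m"
        unfolding L_def n by (rule prime_dvd_lehmer_poly_minus_last[OF m(1)])
      from dvd_diff[OF pL this] have "int p dvd (- 2 * v\<^sup>2) ^ m" by (simp only: diff_diff_eq2 add_diff_cancel_left')
      with pi have "int p dvd - 2 * v\<^sup>2" by (rule prime_dvd_power)
      then have "int p dvd 2 * v\<^sup>2" by simp
      with np2 pi have "int p dvd v\<^sup>2" by (simp add: prime_dvd_mult_iff)
      with pi have pv: "int p dvd v" by (rule prime_dvd_power)
      then have "(int p)\<^sup>2 dvd - 2 * v\<^sup>2" by (intro dvd_mult dvd_power_same)
      then have "(int p)\<^sup>2 dvd L - int (2 * m + 1) * (3 * u\<^sup>2) ^ m"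
        unfolding L_def by (rule dvd_lehmer_poly_minus_lead)
      then have p2: "(int p)\<^sup>2 dvd L - int p * (3 * u\<^sup>2) ^ m" by (simp only: n)
      obtain k where k: "L = int p * k" using pL by blast
      have p0: "int p \<noteq> 0" using p(1) by auto
      have "int p * int p dvd int p * (k - (3 * u\<^sup>2) ^ m)"
        using p2 by (simp add: k power2_eq_square right_diff_distrib)
      then have k2: "int p dvd k - (3 * u\<^sup>2) ^ m" using p0 dvd_mult_cancel_left by blast
      have "\<not> int p dvd k"
      proof
        assume "int p dvd k"
        from dvd_diff[OF this k2] have "int p dvd (3 * u\<^sup>2) ^ m" by (simp only: diff_diff_eq2 add_diff_cancel_left')
        with w show False by blast
      qed
      moreover have "k dvd int p ^ r" using Ld(1) k by (metis dvd_mult_right)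
      ultimately have "\<bar>k\<bar> = 1" using dvd_prime_power_not_dvd p(1) by blast
      then have "\<bar>v\<bar> * int p = \<bar>v * L\<bar>" by (simp add: abs_mult k)
      also have "\<dots> = int p ^ r" by (simp only: d[symmetric] abs_of_nat of_nat_power[symmetric])
      also have "\<dots> = int p ^ (r - 1) * int p" using p(2) by (simp only: power_minus_mult)
      finally have "\<bar>v\<bar> = int p ^ (r - 1)" by (rule mult_right_cancel[OF p0, THEN iffD1])
      then show ?thesis by (simp only: if_not_P[OF False] if_P[OF n])
    next
      case n: False
      \<comment> \<open>Otherwise \<open>L\<close> is congruent to its leading term modulo
        \<open>p\<close>, and that term is prime to \<open>p\<close> because
        \<open>p \<noteq> 2 * m + 1\<close>.\<close>
      have "\<not> int p dvd v"
      proof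
        assume "int p dvd v"
        then have "int p dvd - 2 * v\<^sup>2" by (simp add: power2_eq_square)
        then have "int p dvd L - int (2 * m + 1) * (3 * u\<^sup>2) ^ m"
          unfolding L_def by (rule dvd_lehmer_poly_minus_lead)
        from dvd_diff[OF pL this] have "int p dvd int (2 * m + 1) * (3 * u\<^sup>2) ^ m"
          by (simp only: diff_diff_eq2 add_diff_cancel_left')
        then have "int p dvd int (2 * m + 1)" using w pi prime_dvd_mult_iff by blast
        then show False using prime_not_dvd_prime[OF p(1) m(1) n] by blast
      qed
      then have "\<bar>v\<bar> = 1" by (rule dvd_prime_power_not_dvd[OF p(1) Ld(2)])
      then show ?thesis using n False by simp
    qed
  qed
qed

lemma param_unique:
  fixes u1 v1 u2 v2 :: int and p r m :: nat
  assumes 1: "int p ^ r = v1 * lehmer_poly m (3 * u1\<^sup>2) (- 2 * v1\<^sup>2)" "odd u1" "\<not> int p dvd u1"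
    and 2: "int p ^ r = v2 * lehmer_poly m (3 * u2\<^sup>2) (- 2 * v2\<^sup>2)" "odd u2" "\<not> int p dvd u2"
    and p: "prime p" "r > 0" "\<not> 3 dvd int p ^ r" and m: "prime (2 * m + 1)" "m \<ge> 1"
  shows "u1\<^sup>2 = u2\<^sup>2 \<and> v1\<^sup>2 = v2\<^sup>2"
proof -
  define L1 L2 where "L1 = lehmer_poly m (3 * u1\<^sup>2) (- 2 * v1\<^sup>2)"
    and "L2 = lehmer_poly m (3 * u2\<^sup>2) (- 2 * v2\<^sup>2)"
  have v: "\<bar>v1\<bar> = \<bar>v2\<bar>"
    using abs_param_eq[OF 1(1) p 1(2,3) m] abs_param_eq[OF 2(1) p 2(2,3) m] by simp
  then have v2: "v1\<^sup>2 = v2\<^sup>2" by (metis power2_abs)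
  have "v1 \<noteq> 0" using 1(1) p(1) by auto
  have "\<bar>v1\<bar> * \<bar>L1\<bar> = \<bar>v1\<bar> * \<bar>L2\<bar>"
    using 1(1) 2(1) v unfolding L1_def L2_def by (metis abs_mult)
  then have "\<bar>L1\<bar> = \<bar>L2\<bar>" using \<open>v1 \<noteq> 0\<close> by simp
  moreover have "\<not> 3 dvd v1" "\<not> 3 dvd v2" using 1(1) 2(1) p(3) by (metis dvd_mult2)+
  then have "L1 mod 3 = 1" "L2 mod 3 = 1"
    unfolding L1_def L2_def by (intro lehmer_poly_param_mod_3; simp)+
  \<comment> \<open>Opposite signs are impossible, as both values are 1 modulo 3.\<close>
  ultimately have "L1 = L2" by presburger
  then have "lehmer_poly m (3 * u1\<^sup>2) (- 2 * v1\<^sup>2) = lehmer_poly m (3 * u2\<^sup>2) (- 2 * v1\<^sup>2)"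
    unfolding L1_def L2_def v2 .
  moreover have "4 dvd 3 * u1\<^sup>2 - 3 * u2\<^sup>2"
    using odd_square_mod_4[OF 1(2)] odd_square_mod_4[OF 2(2)] by presburger
  moreover have "odd (3 * u2\<^sup>2)" "even (- 2 * v1\<^sup>2)" using 2(2) by simp_all
  ultimately have "3 * u1\<^sup>2 = 3 * u2\<^sup>2" using m(2) lehmer_poly_inj by blast
  with v2 show ?thesis by simp
qed

theorem theorem1p2:
  fixes n p r :: nat and d :: int
  assumes "prime n" and "odd n"
    and "prime p"
    and "r > 0"
    and "d = int p ^ r"
  shows "\<exists>\<^sub>\<le>\<^sub>1 (z :: int \<times> int). case z of (x, y) \<Rightarrow>
           x > 0 \<and> y > 0 \<and> gcd x y = 1 \<and>
           (x - d)\<^sup>2 + x\<^sup>2 + (x + d)\<^sup>2 = y ^ n"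
proof -
  obtain m where n: "n = 2 * m + 1" using assms(2) by (metis oddE)
  have m: "m \<ge> 1" using assms(1) n by (cases m) auto
  define P where "P = (\<lambda>x y. x > 0 \<and> y > 0 \<and> gcd x y = 1 \<and> (x - d)\<^sup>2 + x\<^sup>2 + (x + d)\<^sup>2 = y ^ n)"
  have eq: "3 * x\<^sup>2 + 2 * d\<^sup>2 = y ^ n" if "P x y" for x y
  proof -
    have "(x - d)\<^sup>2 + x\<^sup>2 + (x + d)\<^sup>2 = 3 * x\<^sup>2 + 2 * d\<^sup>2"
      by (simp add: power2_eq_square algebra_simps)
    then show ?thesis using that by (simp add: P_def)
  qed
  have param: "\<exists>u v. y = 3 * u\<^sup>2 + 2 * v\<^sup>2 \<and> int p ^ r = v * lehmer_poly m (3 * u\<^sup>2) (- 2 * v\<^sup>2)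
      \<and> odd u \<and> \<not> int p dvd u \<and> \<not> 3 dvd int p ^ r" if Pxy: "P x y" for x y
  proof -
    have cop: "coprime x y" and y: "y > 0" using that by (auto simp: P_def coprime_iff_gcd_eq_1)
    have n3: "n \<ge> 3" using n m by simp
    note sc = solution_coprime[OF eq[OF Pxy] cop n3]
    obtain u v where uv: "u dvd x" "y = 3 * u\<^sup>2 + 2 * v\<^sup>2" "d = v * lehmer_poly m (3 * u\<^sup>2) (- 2 * v\<^sup>2)"
      using solution_parametrized[OF eq[OF Pxy] cop n m y] by blast
    have "odd u" using sc(3) uv(2) by auto
    moreover have "\<not> int p dvd u"
    proof
      assume "int p dvd u"
      then have "int p dvd x" using uv(1) by (rule dvd_trans)
      moreover have "int p dvd d" using assms(4,5) by simp
      ultimately have "is_unit (int p)" using sc(1) coprime_common_divisor by blast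
      then show False using assms(3) by simp
    qed
    ultimately show ?thesis using uv(2,3) sc(2) unfolding assms(5) by blast
  qed
  have "x1 = x2 \<and> y1 = y2" if P: "P x1 y1" "P x2 y2" for x1 y1 x2 y2
  proof
    obtain u1 v1 u2 v2 where uv:
      "y1 = 3 * u1\<^sup>2 + 2 * v1\<^sup>2" "int p ^ r = v1 * lehmer_poly m (3 * u1\<^sup>2) (- 2 * v1\<^sup>2)"
      "odd u1" "\<not> int p dvd u1" "\<not> 3 dvd int p ^ r"
      "y2 = 3 * u2\<^sup>2 + 2 * v2\<^sup>2" "int p ^ r = v2 * lehmer_poly m (3 * u2\<^sup>2) (- 2 * v2\<^sup>2)"
      "odd u2" "\<not> int p dvd u2"
      using param[OF P(1)] param[OF P(2)] by blast
    have "prime (2 * m + 1)" using assms(1) n by simp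
    from param_unique[OF uv(2-4) uv(7-9) assms(3,4) uv(5) this m]
    show y: "y1 = y2" using uv(1,6) by simp
    have "x1\<^sup>2 = x2\<^sup>2" using eq[OF P(1)] eq[OF P(2)] y by simp
    then show "x1 = x2" using P by (simp add: P_def power2_eq_iff)
  qed
  then have "\<exists>\<^sub>\<le>\<^sub>1 z. case z of (x, y) \<Rightarrow> P x y" by (auto intro!: Uniq_I)
  then show ?thesis unfolding P_def .
qed

end
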